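(* Let $n\ge2$ and $\Omega=\{(t,y) : y\in\mathbb R^{n-1},\ |y|<1,\ 0<t<1\}$. Let $u,v\in C^2(\Omega)$ satisfy: (a) whenever $(t,y),(s,y)\in\Omega$ and $u(t,y)=v(s,y)$, then $H(\nabla u,\nabla^2u)(t,y)\le H(\nabla v,\nabla^2 v)(s,y)$; (b) $u\ge v$ in $\Omega$; (c) $\max\{u_t,v_t\}>0$ in $\Omega$. Then either $u>v$ in $\Omega$, or $u\equiv v$ in $\Omega$.
   Context: Here $H(\nabla u,\nabla^2u):=\frac1n\,\mathrm{div}\left(\frac{\nabla u}{\sqrt{1+|\nabla u|^2}}\right)$ is the mean curvature of the graph of $u$, with gradient and divergence taken in the variables $(t,y)\in\mathbb R^n$. *)

theory Defs
  imports "HOL-Analysis.Analysis"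
begin

text \<open>Twice continuous (Frechet) differentiability; intended for open \<open>S\<close>, where it is the
  usual class \<open>C\<^sup>2(S)\<close>.\<close>

definition C2_on :: "'a::real_normed_vector set \<Rightarrow> ('a \<Rightarrow> real) \<Rightarrow> bool" where
  "C2_on S f \<longleftrightarrow>
    (\<exists>(f' :: 'a \<Rightarrow> 'a \<Rightarrow>\<^sub>L real) (f'' :: 'a \<Rightarrow> 'a \<Rightarrow>\<^sub>L ('a \<Rightarrow>\<^sub>L real)).
      (\<forall>x\<in>S. (f has_derivative blinfun_apply (f' x)) (at x)) \<and>
      (\<forall>x\<in>S. (f' has_derivative blinfun_apply (f'' x)) (at x)) \<and>
      continuous_on S f'')"

definition grad :: "('a::euclidean_space \<Rightarrow> real) \<Rightarrow> 'a \<Rightarrow> 'a" where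
  "grad f x = (\<Sum>b\<in>Basis. frechet_derivative f (at x) b *\<^sub>R b)"

definition divergence :: "('a::euclidean_space \<Rightarrow> 'a) \<Rightarrow> 'a \<Rightarrow> real" where
  "divergence F x = (\<Sum>b\<in>Basis. frechet_derivative F (at x) b \<bullet> b)"

definition mean_curvature :: "('a::euclidean_space \<Rightarrow> real) \<Rightarrow> 'a \<Rightarrow> real" where
  "mean_curvature u x =
    1 / real DIM('a) *
    divergence (\<lambda>z. (1 / sqrt (1 + (norm (grad u z))\<^sup>2)) *\<^sub>R grad u z) x"

text \<open>Points \<open>(t, y)\<close> of \<open>n\<close>-space are elements of \<open>real \<times> (real ^ 'm)\<close> (whose norm is the
  Euclidean one), with \<open>n = CARD('m) + 1\<close>; as index types are nonempty, this means exactly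
  \<open>n \<ge> 2\<close>.\<close>

definition cylinder :: "(real \<times> (real ^ 'm)) set" where
  "cylinder = {(t, y). norm y < 1 \<and> 0 < t \<and> t < 1}"

definition partial_t :: "(real \<times> 'b \<Rightarrow> real) \<Rightarrow> real \<times> 'b \<Rightarrow> real" where
  "partial_t u p = deriv (\<lambda>s. u (s, snd p)) (fst p)"

end

theory Submission
  imports Defs
begin

text \<open>The curvature hypothesis compares \<open>u\<close> and \<open>v\<close> not at the same point but at points at
  equal height on the same line in the \<open>t\<close>-direction. The proof therefore compares \<open>u\<close> with translates
  of \<open>v\<close> in that direction, by an amount that varies from point to point.

  Where \<open>u = v\<close>, the difference \<open>u - v\<close> has a minimum, so the gradients agree and condition (c)
  gives \<open>v\<^sub>t > 0\<close> there, hence also nearby. If the coincidence set is neither empty nor everything,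
  some closed ball meets it in exactly one point \<open>p\<close>, which lies on the bounding sphere
  (lemma \<open>ball_touching_boundary_of_closed_set\<close>). Around \<open>p\<close>, let \<open>h\<close> be Hopf's barrier
  \<open>exp (-\<alpha> |x - c|\<^sup>2) - exp (-\<alpha> R\<^sup>2)\<close> and slide the functions \<open>x \<mapsto> v (x + (\<epsilon> h(x) + m) e)\<close>, with
  \<open>e\<close> the unit vector of the \<open>t\<close>-axis, upwards by increasing \<open>m\<close> to 0 until they first touch \<open>u\<close>
  from below. At the contact point \<open>x\<close>, with \<open>P = x + (\<epsilon> h(x) + m) e\<close>, the heights \<open>u(x)\<close> and
  \<open>v(P)\<close> are equal, so \<open>H u (x) \<le> H v (P)\<close>. On the other hand, the gradients of \<open>u\<close> and the moved
  function agree at \<open>x\<close> and their Hessians are ordered (\<open>touching_conditions\<close>), so ellipticity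
  (\<open>mc_op_mono\<close>) bounds the curvature of \<open>u\<close> from below by that of the moved function. The latter
  strictly exceeds \<open>H v (P)\<close>, because for large \<open>\<alpha>\<close> the term \<open>v\<^sub>t D\<^sup>2 h\<close> dominates all other effects
  of the shift (\<open>mc_op_strict_increase\<close>). This contradiction is the content of
  \<open>boundary_touching_impossible\<close>.

  This is Hopf's argument for the function \<open>s - t\<close> that solves \<open>u(t, y) = v(s, y)\<close>, with touching
  in place of the linear inequality that this function satisfies. It is carried out in a connected
  open set of a Euclidean space with a distinguished unit vector \<open>e\<close>.\<close>

section \<open>The mean curvature operator and its monotonicity\<close>

text \<open>For a \<open>C\<^sup>2\<close> function with gradient \<open>q\<close> and Hessian \<open>A\<close> at a point, this is
  \<open>div (\<nabla>u / W)\<close> in non-divergence form, where \<open>W = sqrt (1 + |q|\<^sup>2)\<close>. Here \<open>A\<close> is an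
  arbitrary function of two arguments, so that comparison Hessians can be written down as terms
  without first being turned into bounded operators.\<close>

definition mc_op :: "'a::euclidean_space \<Rightarrow> ('a \<Rightarrow> 'a \<Rightarrow> real) \<Rightarrow> real" where
  "mc_op q A = (\<Sum>b\<in>Basis. A b b) / sqrt (1 + (norm q)\<^sup>2) - A q q / sqrt (1 + (norm q)\<^sup>2) ^ 3"

text \<open>Evaluating the form at the vectors \<open>p\<^sub>i e\<^sub>j - p\<^sub>j e\<^sub>i\<close> and summing over all \<open>i, j\<close> gives
  exactly \<open>2 (|p|\<^sup>2 tr C - C p p)\<close>.\<close>

lemma psd_form_le_trace:
  fixes C :: "'a::euclidean_space \<Rightarrow> 'a \<Rightarrow> real"
  assumes bil: "bilinear C" and psd: "\<And>x. C x x \<ge> 0"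
  shows "C p p \<le> (norm p)\<^sup>2 * (\<Sum>b\<in>Basis. C b b)"
proof -
  define T where "T = (\<Sum>b\<in>Basis. C b b)"
  have Cpp: "C p p = (\<Sum>i\<in>Basis. \<Sum>j\<in>Basis. (p \<bullet> i) * (p \<bullet> j) * C i j)"
  proof -
    have "C p p = C (\<Sum>i\<in>Basis. (p \<bullet> i) *\<^sub>R i) (\<Sum>j\<in>Basis. (p \<bullet> j) *\<^sub>R j)"
      by (simp add: euclidean_representation)
    also have "\<dots> = (\<Sum>(i,j)\<in>Basis\<times>Basis. C ((p \<bullet> i) *\<^sub>R i) ((p \<bullet> j) *\<^sub>R j))"
      by (rule bilinear_sum[OF bil])
    also have "\<dots> = (\<Sum>i\<in>Basis. \<Sum>j\<in>Basis. (p \<bullet> i) * (p \<bullet> j) * C i j)"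
      by (simp add: sum.cartesian_product bilinear_lmul[OF bil] bilinear_rmul[OF bil] mult_ac)
    finally show ?thesis .
  qed
  have np: "(norm p)\<^sup>2 = (\<Sum>i\<in>Basis. (p \<bullet> i)\<^sup>2)"
    by (simp only: norm_eq_sqrt_inner real_sqrt_pow2[OF inner_ge_zero], subst euclidean_inner, simp add: power2_eq_square)
  have "0 \<le> (\<Sum>i\<in>Basis. \<Sum>j\<in>Basis.
      C ((p \<bullet> i) *\<^sub>R j - (p \<bullet> j) *\<^sub>R i) ((p \<bullet> i) *\<^sub>R j - (p \<bullet> j) *\<^sub>R i))"
    by (intro sum_nonneg psd)
  also have "\<dots> = (\<Sum>i\<in>Basis. \<Sum>j\<in>Basis. (p \<bullet> i)\<^sup>2 * C j j) + (\<Sum>i\<in>Basis. \<Sum>j\<in>Basis. (p \<bullet> j)\<^sup>2 * C i i)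
       - (\<Sum>i\<in>Basis. \<Sum>j\<in>Basis. (p \<bullet> i) * (p \<bullet> j) * C i j)
       - (\<Sum>i\<in>Basis. \<Sum>j\<in>Basis. (p \<bullet> j) * (p \<bullet> i) * C j i)"
    by (simp only: sum.distrib[symmetric] sum_subtractf[symmetric])
       (simp add: bilinear_lsub[OF bil] bilinear_rsub[OF bil] bilinear_lmul[OF bil] bilinear_rmul[OF bil]
         algebra_simps power2_eq_square)
  also have "(\<Sum>i\<in>Basis. \<Sum>j\<in>Basis. (p \<bullet> i)\<^sup>2 * C j j) = (norm p)\<^sup>2 * T"
    by (simp add: np T_def sum_product)
  also have "(\<Sum>i\<in>Basis. \<Sum>j\<in>Basis. (p \<bullet> j)\<^sup>2 * C i i) = (norm p)\<^sup>2 * T"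
    unfolding np T_def sum_product by (rule sum.swap)
  also have "(\<Sum>i\<in>Basis. \<Sum>j\<in>Basis. (p \<bullet> j) * (p \<bullet> i) * C j i) = C p p"
    unfolding Cpp by (rule sum.swap)
  finally show ?thesis unfolding Cpp[symmetric] T_def by (simp add: mult.commute)
qed

lemma mc_op_diff:
  "mc_op q (\<lambda>x y. A x y - B x y) = mc_op q A - mc_op q B"
  by (simp add: mc_op_def sum_subtractf diff_divide_distrib)

text \<open>Degenerate ellipticity. The operator is linear in the Hessian, and for a difference \<open>C\<close> of
  Hessians its value is \<open>(W\<^sup>2 tr C - C q q) / W\<^sup>3\<close>, which the trace bound makes nonnegative for
  positive semidefinite \<open>C\<close>.\<close>

lemma mc_op_mono:
  assumes A: "bilinear A" and B: "bilinear B" and le: "\<And>x. B x x \<le> A x x"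
  shows "mc_op q B \<le> mc_op q A"
proof -
  define C where "C x y = A x y - B x y" for x y
  define W where "W = sqrt (1 + (norm q)\<^sup>2)"
  have W: "W > 0" "W\<^sup>2 = 1 + (norm q)\<^sup>2" by (auto simp: W_def add_pos_nonneg)
  have C: "bilinear C"
    using A B unfolding bilinear_def C_def by (auto intro: linear_compose_sub)
  have psd: "C x x \<ge> 0" for x using le by (simp add: C_def)
  have "C q q \<le> (norm q)\<^sup>2 * (\<Sum>b\<in>Basis. C b b)"
    by (rule psd_form_le_trace[OF C psd])
  also have "\<dots> \<le> W\<^sup>2 * (\<Sum>b\<in>Basis. C b b)"
    by (intro mult_right_mono sum_nonneg psd) (simp add: W)
  finally have "0 \<le> (W\<^sup>2 * (\<Sum>b\<in>Basis. C b b) - C q q) / W ^ 3"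
    using W by simp
  also have "\<dots> = mc_op q C"
    using W(1) unfolding mc_op_def W_def[symmetric]
    by (simp add: field_simps power2_eq_square power3_eq_cube)
  also have "\<dots> = mc_op q A - mc_op q B"
    unfolding mc_op_diff[symmetric] C_def[abs_def] ..
  finally show ?thesis by simp
qed

lemma grad_eq:
  assumes "(f has_derivative blinfun_apply f') (at x)"
  shows "grad f x = (\<Sum>b\<in>Basis. f' b *\<^sub>R b)"
  using frechet_derivative_at[OF assms] by (simp add: grad_def)

text \<open>The gradient is assembled from coordinates; this is its coordinate-free characterisation, by
  which equality of first derivatives turns into equality of gradients.\<close>

lemma grad_inner:
  assumes "(f has_derivative blinfun_apply f') (at x)"
  shows "f' y = grad f x \<bullet> y"
proof -
  have "f' y = f' (\<Sum>b\<in>Basis. (y \<bullet> b) *\<^sub>R b)" by (simp add: euclidean_representation)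
  also have "\<dots> = (\<Sum>b\<in>Basis. (y \<bullet> b) * f' b)" by (simp add: blinfun.sum_right blinfun.scaleR_right)
  also have "\<dots> = grad f x \<bullet> y"
    by (simp add: grad_eq[OF assms] inner_sum_left inner_commute[of y] mult.commute)
  finally show ?thesis .
qed

lemma norm_grad_le:
  assumes "(f has_derivative blinfun_apply f') (at x)"
  shows "norm (grad f x) \<le> norm f'"
proof -
  have "norm (grad f x) * norm (grad f x) = f' (grad f x)"
    by (simp add: grad_inner[OF assms] power2_norm_eq_inner flip: power2_eq_square)
  also have "\<dots> \<le> norm f' * norm (grad f x)"
    using norm_blinfun[of f' "grad f x"] by simp
  finally show ?thesis
    by (cases "grad f x = 0") auto
qed

lemma mean_curvature_eq_mc_op:
  fixes f :: "'a::euclidean_space \<Rightarrow> real"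
  assumes S: "open S" "x \<in> S"
    and f': "\<And>x. x \<in> S \<Longrightarrow> (f has_derivative blinfun_apply (f' x)) (at x)"
    and f'': "(f' has_derivative blinfun_apply f'') (at x)"
  shows "mean_curvature f x = 1 / real DIM('a) * mc_op (grad f x) (\<lambda>x. blinfun_apply (blinfun_apply f'' x))"
proof -
  define G where "G z = (\<Sum>b\<in>Basis. f' z b *\<^sub>R b)" for z
  define G' where "G' y = (\<Sum>b\<in>Basis. f'' y b *\<^sub>R b)" for y
  define W where "W = sqrt (1 + (norm (G x))\<^sup>2)"
  have G: "grad f z = G z" if "z \<in> S" for z
    using grad_eq[OF f'[OF that]] by (simp add: G_def)
  have dG: "(G has_derivative G') (at x)"
    unfolding G_def[abs_def] G'_def[abs_def]
    by (auto intro!: derivative_eq_intros f'' simp: blinfun.zero_right)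
  have W: "W > 0" "W\<^sup>2 = 1 + G x \<bullet> G x" by (auto simp: W_def add_pos_nonneg power2_norm_eq_inner)
  define D where "D y = (1 / W) *\<^sub>R G' y - ((G x \<bullet> G' y) / W ^ 3) *\<^sub>R G x" for y
  have "((\<lambda>z. (1 / sqrt (1 + G z \<bullet> G z)) *\<^sub>R G z) has_derivative D) (at x)"
  proof (rule has_derivative_eq_rhs)
    have nz: "1 + G x \<bullet> G x > 0" by (simp add: add_pos_nonneg)
    show "((\<lambda>z. (1 / sqrt (1 + G z \<bullet> G z)) *\<^sub>R G z) has_derivative
      (\<lambda>y. (1 / W) *\<^sub>R G' y + (- (2 * (G x \<bullet> G' y) * (inverse W / 2)) / (W * W)) *\<^sub>R G x)) (at x)"
      using nz
      by (auto intro!: derivative_eq_intros dG simp: W_def power2_norm_eq_inner inner_commute divide_simps fun_eq_iff)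
    show "(\<lambda>y. (1 / W) *\<^sub>R G' y + (- (2 * (G x \<bullet> G' y) * (inverse W / 2)) / (W * W)) *\<^sub>R G x) = D"
      using W(1) by (simp add: D_def fun_eq_iff power3_eq_cube divide_simps)
  qed
  then have "((\<lambda>z. (1 / sqrt (1 + (norm (grad f z))\<^sup>2)) *\<^sub>R grad f z) has_derivative D) (at x)"
    by (rule has_derivative_transform_within_open[OF _ S]) (simp add: G power2_norm_eq_inner)
  then have "divergence (\<lambda>z. (1 / sqrt (1 + (norm (grad f z))\<^sup>2)) *\<^sub>R grad f z) x = (\<Sum>b\<in>Basis. D b \<bullet> b)"
    unfolding divergence_def by (simp add: frechet_derivative_at[symmetric])
  also have "\<dots> = (\<Sum>b\<in>Basis. f'' b b / W) - (\<Sum>b\<in>Basis. (G x \<bullet> b) * (G x \<bullet> G' b)) / W ^ 3"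
    unfolding sum_divide_distrib sum_subtractf[symmetric]
    by (intro sum.cong refl) (simp add: D_def inner_diff_left G'_def inner_sum_left inner_Basis if_distrib sum.delta cong: if_cong)
  also have "(\<Sum>b\<in>Basis. (G x \<bullet> b) * (G x \<bullet> G' b)) = f'' (G x) (G x)"
  proof -
    have "G x \<bullet> G' b = f'' b (G x)" for b
    proof -
      have "G x \<bullet> G' b = (\<Sum>c\<in>Basis. (G x \<bullet> c) * f'' b c)" by (simp add: G'_def inner_sum_right mult_ac)
      also have "\<dots> = f'' b (\<Sum>c\<in>Basis. (G x \<bullet> c) *\<^sub>R c)" by (simp add: blinfun.sum_right blinfun.scaleR_right)
      finally show ?thesis by (simp add: euclidean_representation)
    qed
    then have "(\<Sum>b\<in>Basis. (G x \<bullet> b) * (G x \<bullet> G' b)) = f'' (\<Sum>b\<in>Basis. (G x \<bullet> b) *\<^sub>R b) (G x)"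
      by (simp add: blinfun.sum_right blinfun.scaleR_right blinfun.sum_left blinfun.scaleR_left)
    then show ?thesis by (simp add: euclidean_representation)
  qed
  finally show ?thesis
    by (simp add: mean_curvature_def mc_op_def G[OF S(2)] W_def sum_divide_distrib)
qed

section \<open>A strict subsolution from an exponential barrier\<close>

lemma abs_mult_diff_le:
  fixes a b x y :: real
  assumes "\<bar>x - y\<bar> \<le> d" "\<bar>y\<bar> \<le> Y" "\<bar>a - b\<bar> \<le> c" "\<bar>a\<bar> \<le> 1"
  shows "\<bar>x * a - y * b\<bar> \<le> d + Y * c"
proof -
  have "x * a - y * b = (x - y) * a + y * (a - b)" by (simp add: algebra_simps)
  then have "\<bar>x * a - y * b\<bar> \<le> \<bar>x - y\<bar> * \<bar>a\<bar> + \<bar>y\<bar> * \<bar>a - b\<bar>"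
    by (metis abs_mult abs_triangle_ineq)
  also have "\<bar>x - y\<bar> * \<bar>a\<bar> \<le> d * 1" using assms by (intro mult_mono) auto
  also have "\<bar>y\<bar> * \<bar>a - b\<bar> \<le> Y * c" using assms by (intro mult_mono) auto
  finally show ?thesis by simp
qed

lemma blinfun2_bound:
  fixes A :: "'a::real_normed_vector \<Rightarrow>\<^sub>L 'a \<Rightarrow>\<^sub>L real"
  assumes "norm A \<le> M"
  shows "\<bar>A x y\<bar> \<le> M * norm x * norm y"
proof -
  have "\<bar>A x y\<bar> \<le> norm (A x) * norm y" using norm_blinfun[of "A x" y] by simp
  also have "\<dots> \<le> norm A * norm x * norm y" by (intro mult_right_mono norm_blinfun) auto
  also have "\<dots> \<le> M * norm x * norm y" using assms by (intro mult_right_mono) auto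
  finally show ?thesis .
qed

lemma blinfun2_quad_diff:
  fixes A :: "'a::real_normed_vector \<Rightarrow>\<^sub>L 'a \<Rightarrow>\<^sub>L real"
  assumes "norm A \<le> M"
  shows "\<bar>A x x - A y y\<bar> \<le> M * norm (x - y) * (norm x + norm y)"
proof -
  have "A x x - A y y = A (x - y) x + A y (x - y)"
    by (simp add: blinfun.diff_left blinfun.diff_right)
  also have "\<bar>\<dots>\<bar> \<le> \<bar>A (x - y) x\<bar> + \<bar>A y (x - y)\<bar>" by simp
  also have "\<dots> \<le> M * norm (x - y) * norm x + M * norm y * norm (x - y)"
    by (intro add_mono blinfun2_bound assms)
  finally show ?thesis by (simp add: algebra_simps)
qed

text \<open>An error of order \<open>d\<close> in the gradient and in the Hessian changes the operator by at most a
  constant times \<open>d\<close>. The explicit constant depends only on the dimension and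
  on the bounds \<open>M\<close> and \<open>c\<close>; this uniformity
  allows the steepness of the barrier to be fixed before its amplitude.\<close>

lemma mc_op_lipschitz:
  fixes A :: "'a::euclidean_space \<Rightarrow>\<^sub>L 'a \<Rightarrow>\<^sub>L real"
  assumes M: "M \<ge> 0" and c: "c \<ge> 0" and d: "0 \<le> d" "d \<le> 1"
    and q: "norm q \<le> M" and A: "norm A \<le> M" and qp: "norm (p - q) \<le> d * c"
    and B: "\<And>x. \<bar>B x x - A x x\<bar> \<le> d * c * (norm x)\<^sup>2"
  shows "\<bar>mc_op p B - mc_op q A\<bar>
     \<le> d * (real DIM('a) * (c + M * c) + (c * (M + c)\<^sup>2 + M * c * (2 * M + c)) + 3 * M ^ 3 * c)"
proof -
  let ?n = "real DIM('a)"
  define W where "W q = sqrt (1 + (norm q)\<^sup>2)" for q :: 'a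
  have W1: "W q \<ge> 1" for q by (simp add: W_def)
  have dc: "d * c \<le> c" using mult_right_mono[OF d(2) c] by simp
  have np: "norm p \<le> M + c"
    using norm_triangle_ineq[of q "p - q"] q qp dc by simp
  \<comment> \<open>Seen as the norm of \<open>(1, q)\<close>, the function \<open>W\<close> is 1-Lipschitz by the triangle inequality.\<close>
  have Wn: "W q = norm (1::real, q)" for q by (simp add: W_def norm_Pair)
  have "\<bar>W p - W q\<bar> \<le> norm ((1::real, p) - (1, q))"
    unfolding Wn by (rule norm_triangle_ineq3)
  then have Wpq: "\<bar>W p - W q\<bar> \<le> d * c" using qp by simp
  have "\<bar>1 / W p - 1 / W q\<bar> = \<bar>W p - W q\<bar> / (W p * W q)"
    using W1[of p] W1[of q] by (simp add: divide_simps abs_mult abs_minus_commute)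
  also have "\<dots> \<le> \<bar>W p - W q\<bar> / 1"
    using W1[of p] W1[of q] mult_mono[OF W1[of p] W1[of q]] by (intro divide_left_mono) auto
  finally have inv: "\<bar>1 / W p - 1 / W q\<bar> \<le> d * c" using Wpq by simp
  have i1: "0 \<le> 1 / W q" "1 / W q \<le> 1" for q using W1[of q] by auto
  have inv3: "\<bar>(1 / W p) ^ 3 - (1 / W q) ^ 3\<bar> \<le> 3 * (d * c)"
  proof -
    define a b where "a = 1 / W p" and "b = 1 / W q"
    have ab: "0 \<le> a" "a \<le> 1" "0 \<le> b" "b \<le> 1" using i1 by (auto simp: a_def b_def)
    have "a ^ 3 - b ^ 3 = (a - b) * (a * a + a * b + b * b)"
      by (simp add: algebra_simps power3_eq_cube)
    then have "\<bar>a ^ 3 - b ^ 3\<bar> = \<bar>a - b\<bar> * (a * a + a * b + b * b)"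
      using ab by (simp add: abs_mult)
    also have "\<dots> \<le> (d * c) * 3"
      using inv ab mult_mono[of a 1 a 1] mult_mono[of a 1 b 1] mult_mono[of b 1 b 1]
      by (intro mult_mono) (auto simp: a_def[symmetric] b_def[symmetric])
    finally show ?thesis by (simp add: a_def b_def)
  qed
  have tr: "\<bar>(\<Sum>b\<in>Basis. B b b) - (\<Sum>b\<in>Basis. A b b)\<bar> \<le> ?n * (d * c)"
  proof -
    have "\<bar>B b b - A b b\<bar> \<le> d * c" if "b \<in> Basis" for b
      using B[of b] that by simp
    then have "\<bar>(\<Sum>b\<in>Basis. B b b - A b b)\<bar> \<le> (\<Sum>b\<in>(Basis::'a set). d * c)"
      by (intro order_trans[OF sum_abs] sum_mono) auto
    then show ?thesis by (simp add: sum_subtractf)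
  qed
  have trA: "\<bar>\<Sum>b\<in>Basis. A b b\<bar> \<le> ?n * M"
  proof -
    have "\<bar>A b b\<bar> \<le> M" if "b \<in> Basis" for b
      using blinfun2_bound[OF A, of b b] that by simp
    then have "\<bar>\<Sum>b\<in>Basis. A b b\<bar> \<le> (\<Sum>b\<in>(Basis::'a set). M)"
      by (intro order_trans[OF sum_abs] sum_mono) auto
    then show ?thesis by simp
  qed
  have Aqq: "\<bar>A q q\<bar> \<le> M ^ 3"
  proof -
    have "\<bar>A q q\<bar> \<le> M * norm q * norm q" by (rule blinfun2_bound[OF A])
    also have "\<dots> \<le> M * M * M" using q M by (intro mult_mono) auto
    finally show ?thesis by (simp add: power3_eq_cube)
  qed
  have qq: "\<bar>B p p - A q q\<bar> \<le> d * (c * (M + c)\<^sup>2 + M * c * (2 * M + c))"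
  proof -
    have "\<bar>B p p - A p p\<bar> \<le> d * c * (norm p)\<^sup>2" by (rule B)
    also have "\<dots> \<le> d * c * (M + c)\<^sup>2" using np d c by (intro mult_left_mono power_mono) auto
    finally have 1: "\<bar>B p p - A p p\<bar> \<le> d * c * (M + c)\<^sup>2" .
    have "\<bar>A p p - A q q\<bar> \<le> M * norm (p - q) * (norm p + norm q)" by (rule blinfun2_quad_diff[OF A])
    also have "\<dots> \<le> M * (d * c) * ((M + c) + M)" using qp np q M c d by (intro mult_mono add_mono) auto
    finally have "\<bar>A p p - A q q\<bar> \<le> M * (d * c) * ((M + c) + M)" .
    with 1 show ?thesis by (simp add: algebra_simps)
  qed
  have "\<bar>(\<Sum>b\<in>Basis. B b b) * (1 / W p) - (\<Sum>b\<in>Basis. A b b) * (1 / W q)\<bar>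
      \<le> ?n * (d * c) + ?n * M * (d * c)"
    by (rule abs_mult_diff_le[OF tr trA inv]) (use i1[of p] in auto)
  moreover have "\<bar>B p p * (1 / W p) ^ 3 - A q q * (1 / W q) ^ 3\<bar>
      \<le> d * (c * (M + c)\<^sup>2 + M * c * (2 * M + c)) + M ^ 3 * (3 * (d * c))"
    by (rule abs_mult_diff_le[OF qq Aqq inv3]) (use i1[of p] in \<open>auto simp: power_le_one\<close>)
  moreover have "mc_op p B - mc_op q A =
      ((\<Sum>b\<in>Basis. B b b) * (1 / W p) - (\<Sum>b\<in>Basis. A b b) * (1 / W q))
      - (B p p * (1 / W p) ^ 3 - A q q * (1 / W q) ^ 3)"
    by (simp add: mc_op_def W_def power_one_over)
  ultimately have "\<bar>mc_op p B - mc_op q A\<bar> \<le> (?n * (d * c) + ?n * M * (d * c))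
     + (d * (c * (M + c)\<^sup>2 + M * c * (2 * M + c)) + M ^ 3 * (3 * (d * c)))"
    by linarith
  then show ?thesis by (simp add: algebra_simps)
qed

lemma mc_op_add_scaled:
  "mc_op q (\<lambda>x y. A x y + k * B x y) = mc_op q A + k * mc_op q B"
  by (simp add: mc_op_def sum.distrib sum_distrib_left[symmetric] add_divide_distrib algebra_simps)

text \<open>Up to the factor \<open>2 \<epsilon> \<alpha> exp (-\<alpha> |z|\<^sup>2)\<close>, the Hessian of \<open>\<epsilon> exp (-\<alpha> |x - c|\<^sup>2)\<close> at \<open>x = c + z\<close>
  is \<open>2 \<alpha> z \<otimes> z - I\<close>. By Cauchy-Schwarz the rank-one part contributes at least
  \<open>2 \<alpha> |z|\<^sup>2 / W\<^sup>3\<close>, whereas the identity costs at most the dimension. So a large \<open>\<alpha>\<close> wins as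
  long as \<open>|z|\<close> stays away from zero.\<close>

lemma mc_op_barrier_ge:
  fixes q z :: "'a::euclidean_space"
  assumes "\<alpha> \<ge> 0"
  shows "mc_op q (\<lambda>x y. 2 * \<alpha> * ((z \<bullet> x) * (z \<bullet> y)) - x \<bullet> y)
    \<ge> 2 * \<alpha> * (norm z)\<^sup>2 / (1 + norm q) ^ 3 - real DIM('a)"
proof -
  define W where "W = sqrt (1 + (norm q)\<^sup>2)"
  have W: "W \<ge> 1" "W\<^sup>2 = 1 + (norm q)\<^sup>2" "W \<le> 1 + norm q"
    using sqrt_add_le_add_sqrt[of 1 "(norm q)\<^sup>2"] by (auto simp: W_def add_pos_nonneg)
  have nz: "(norm z)\<^sup>2 = (\<Sum>i\<in>Basis. (z \<bullet> i) * (z \<bullet> i))"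
    by (simp only: norm_eq_sqrt_inner real_sqrt_pow2[OF inner_ge_zero], subst euclidean_inner, simp)
  have "(z \<bullet> q)\<^sup>2 \<le> (norm z)\<^sup>2 * (norm q)\<^sup>2"
    using Cauchy_Schwarz_ineq[of z q] by (simp add: power2_norm_eq_inner)
  then have "(norm z)\<^sup>2 / W ^ 3 \<le> (W\<^sup>2 * (norm z)\<^sup>2 - (z \<bullet> q)\<^sup>2) / W ^ 3"
    using W by (intro divide_right_mono) (auto simp: algebra_simps)
  also have "\<dots> = mc_op q (\<lambda>x y. (z \<bullet> x) * (z \<bullet> y))"
    unfolding mc_op_def W_def[symmetric] nz[symmetric]
    using W(1) by (simp add: field_simps power2_eq_square power3_eq_cube)
  finally have 1: "(norm z)\<^sup>2 / W ^ 3 \<le> mc_op q (\<lambda>x y. (z \<bullet> x) * (z \<bullet> y))" .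
  have "(norm z)\<^sup>2 / (1 + norm q) ^ 3 \<le> (norm z)\<^sup>2 / W ^ 3"
    using W by (intro divide_left_mono power_mono mult_pos_pos zero_less_power) auto
  with 1 have 1: "(norm z)\<^sup>2 / (1 + norm q) ^ 3 \<le> mc_op q (\<lambda>x y. (z \<bullet> x) * (z \<bullet> y))" by simp
  have "mc_op q (\<lambda>x y. x \<bullet> y) = real DIM('a) / W - (norm q)\<^sup>2 / W ^ 3"
    by (simp add: mc_op_def W_def power2_norm_eq_inner inner_Basis)
  also have "\<dots> \<le> real DIM('a) / W" using W by simp
  also have "\<dots> \<le> real DIM('a) / 1" using W by (intro divide_left_mono) auto
  finally have 2: "mc_op q (\<lambda>x y. x \<bullet> y) \<le> real DIM('a)" by simp
  have "mc_op q (\<lambda>x y. 2 * \<alpha> * ((z \<bullet> x) * (z \<bullet> y)) - x \<bullet> y)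
     = 2 * \<alpha> * mc_op q (\<lambda>x y. (z \<bullet> x) * (z \<bullet> y)) - mc_op q (\<lambda>x y. x \<bullet> y)"
    by (simp add: mc_op_def sum_subtractf sum_distrib_left[symmetric] diff_divide_distrib right_diff_distrib)
  moreover have "2 * \<alpha> * ((norm z)\<^sup>2 / (1 + norm q) ^ 3) \<le> 2 * \<alpha> * mc_op q (\<lambda>x y. (z \<bullet> x) * (z \<bullet> y))"
    using assms 1 by (intro mult_left_mono) auto
  ultimately show ?thesis using 2 by simp
qed

text \<open>The right-hand side is the operator at the gradient of \<open>x \<mapsto> v (x + \<psi>(x) e)\<close> and its Hessian, where \<open>\<psi>\<close> is a
  small multiple of the barrier plus a constant: the first derivative of the shift is \<open>-d z\<close>, and
  \<open>\<kappa>\<close> is the derivative of \<open>v\<close> in the direction \<open>e\<close>. All effects of the shift are of first order in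
  \<open>d\<close>; their total is at least \<open>d\<close> times a positive multiple of \<open>\<alpha>\<close>, minus \<open>d\<close> times a constant that does
  not depend on \<open>\<alpha>\<close>. One \<open>\<alpha>\<close> therefore serves for all \<open>d\<close> up to 1.\<close>

lemma mc_op_strict_increase:
  fixes e :: "'a::euclidean_space"
  assumes M: "M \<ge> 0" and k0: "\<kappa>0 > 0" and r: "\<rho> > 0" and e: "norm e \<le> 1"
  obtains \<alpha> :: real where "\<alpha> > 0"
    "\<And>(q::'a) z (A :: 'a \<Rightarrow>\<^sub>L 'a \<Rightarrow>\<^sub>L real) \<kappa> d.
      norm q \<le> M \<Longrightarrow> norm z \<le> M \<Longrightarrow> norm A \<le> M \<Longrightarrow> \<kappa>0 \<le> \<kappa> \<Longrightarrow> \<kappa> \<le> M \<Longrightarrow> \<rho> \<le> norm z \<Longrightarrow>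
      0 < d \<Longrightarrow> d \<le> 1 \<Longrightarrow>
      mc_op q (\<lambda>x. blinfun_apply (blinfun_apply A x)) <
      mc_op (q - (d * \<kappa>) *\<^sub>R z)
       (\<lambda>x y. A (x - (d * (z \<bullet> x)) *\<^sub>R e) (y - (d * (z \<bullet> y)) *\<^sub>R e)
          + d * \<kappa> * (2 * \<alpha> * ((z \<bullet> x) * (z \<bullet> y)) - x \<bullet> y))"
proof -
  define c where "c = M * M * (2 + M)"
  have c: "c \<ge> 0" using M by (simp add: c_def)
  define c' where "c' = c + M * M"
  have c': "c' \<ge> 0" "c \<le> c'" "M * M \<le> c'" using M c by (auto simp: c'_def)
  define K where "K = real DIM('a) * (c' + M * c') + (c' * (M + c')\<^sup>2 + M * c' * (2 * M + c')) + 3 * M ^ 3 * c'"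
  have K: "K \<ge> 0" using M c' by (auto simp: K_def intro!: add_nonneg_nonneg mult_nonneg_nonneg)
  define m where "m = (1 + (M + c')) ^ 3"
  have m: "m > 0" using M c' by (simp add: m_def)
  \<comment> \<open>Chosen to make the barrier bound equal to \<open>(K + 1) / \<kappa>0\<close>, where \<open>K d\<close> bounds the error terms.\<close>
  define \<alpha> where "\<alpha> = ((K + 1) / \<kappa>0 + real DIM('a)) * m / (2 * \<rho>\<^sup>2)"
  have "(K + 1) / \<kappa>0 > 0" using K k0 by simp
  then have al: "\<alpha> > 0"
    unfolding \<alpha>_def using m r by (intro divide_pos_pos[of "_ * _"] mult_pos_pos add_pos_nonneg) auto
  show thesis
  proof (rule that[OF al])
    fix q z :: 'a and A :: "'a \<Rightarrow>\<^sub>L 'a \<Rightarrow>\<^sub>L real" and \<kappa> d :: real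
    assume q: "norm q \<le> M" and z: "norm z \<le> M" and A: "norm A \<le> M" and k: "\<kappa>0 \<le> \<kappa>" "\<kappa> \<le> M"
      and rz: "\<rho> \<le> norm z" and d: "0 < d" "d \<le> 1"
    define B where "B x y = A (x - (d * (z \<bullet> x)) *\<^sub>R e) (y - (d * (z \<bullet> y)) *\<^sub>R e)" for x y
    define p where "p = q - (d * \<kappa>) *\<^sub>R z"
    have "norm (p - q) = d * (\<kappa> * norm z)" using d k k0 by (simp add: p_def abs_mult)
    also have "\<dots> \<le> d * (M * M)" using d k k0 z M by (intro mult_left_mono mult_mono) auto
    also have "\<dots> \<le> d * c'" using d c' by (intro mult_left_mono) auto
    finally have pq: "norm (p - q) \<le> d * c'" .
    have B: "\<bar>B x x - A x x\<bar> \<le> d * c' * (norm x)\<^sup>2" for x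
    proof -
      define X where "X = x - (d * (z \<bullet> x)) *\<^sub>R e"
      have "norm (X - x) = d * \<bar>z \<bullet> x\<bar> * norm e" using d by (simp add: X_def abs_mult)
      also have "\<dots> \<le> d * (M * norm x) * 1"
        using d e M order_trans[OF Cauchy_Schwarz_ineq2[of z x] mult_right_mono[OF z norm_ge_zero[of x]]]
        by (intro mult_mono) auto
      finally have Xx: "norm (X - x) \<le> d * (M * norm x)" by simp
      also have "\<dots> \<le> 1 * (M * norm x)" using d M by (intro mult_right_mono) auto
      finally have X: "norm X \<le> (1 + M) * norm x"
        using norm_triangle_ineq[of x "X - x"] by (simp add: algebra_simps)
      have "\<bar>B x x - A x x\<bar> \<le> M * norm (X - x) * (norm X + norm x)"
        unfolding B_def X_def[symmetric] by (rule blinfun2_quad_diff[OF A])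
      also have "\<dots> \<le> M * (d * (M * norm x)) * ((1 + M) * norm x + norm x)"
        using Xx X M d by (intro mult_mono add_mono) auto
      also have "\<dots> = d * c * (norm x)\<^sup>2" by (simp add: c_def algebra_simps power2_eq_square)
      also have "\<dots> \<le> d * c' * (norm x)\<^sup>2" using d c' by (intro mult_right_mono mult_left_mono) auto
      finally show ?thesis .
    qed
    have lip: "\<bar>mc_op p B - mc_op q A\<bar> \<le> d * K"
      unfolding K_def using d by (intro mc_op_lipschitz M c'(1) q A pq B) auto
    have "d * c' \<le> c'" using mult_right_mono[OF d(2) c'(1)] by simp
    then have np: "norm p \<le> M + c'"
      using norm_triangle_ineq[of q "p - q"] q pq by simp
    define b where "b = mc_op p (\<lambda>x y. 2 * \<alpha> * ((z \<bullet> x) * (z \<bullet> y)) - x \<bullet> y)"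
    have "2 * \<alpha> * \<rho>\<^sup>2 / m \<le> 2 * \<alpha> * (norm z)\<^sup>2 / (1 + norm p) ^ 3"
      unfolding m_def using np rz r al
      by (intro frac_le mult_left_mono power_mono zero_less_power add_pos_nonneg) auto
    moreover have "2 * \<alpha> * \<rho>\<^sup>2 / m = (K + 1) / \<kappa>0 + real DIM('a)"
      using m r by (simp add: \<alpha>_def)
    ultimately have "b \<ge> (K + 1) / \<kappa>0"
      using mc_op_barrier_ge[of \<alpha> z p] al unfolding b_def by simp
    then have "K + 1 \<le> \<kappa>0 * b" using k0 by (simp add: field_simps)
    moreover have "b \<ge> 0" using \<open>b \<ge> (K + 1) / \<kappa>0\<close> K k0 by (meson add_nonneg_nonneg divide_nonneg_pos order_trans zero_le_one)
    ultimately have "K + 1 \<le> \<kappa> * b" using mult_right_mono[OF k(1)] by fastforce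
    then have "d * (K + 1) \<le> d * \<kappa> * b" using d by (simp add: mult.assoc)
    then have "d * K < d * \<kappa> * b" using d by (simp only: distrib_left mult_1_right)
    then have "mc_op q A < mc_op p B + d * \<kappa> * b" using lip by linarith
    also have "\<dots> = mc_op p (\<lambda>x y. B x y + d * \<kappa> * (2 * \<alpha> * ((z \<bullet> x) * (z \<bullet> y)) - x \<bullet> y))"
      by (simp only: mc_op_add_scaled b_def)
    finally show "mc_op q (\<lambda>x. blinfun_apply (blinfun_apply A x)) <
      mc_op (q - (d * \<kappa>) *\<^sub>R z)
       (\<lambda>x y. A (x - (d * (z \<bullet> x)) *\<^sub>R e) (y - (d * (z \<bullet> y)) *\<^sub>R e)
          + d * \<kappa> * (2 * \<alpha> * ((z \<bullet> x) * (z \<bullet> y)) - x \<bullet> y))"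
      by (simp add: p_def B_def)
  qed
qed



section \<open>Touching after a variable shift\<close>

lemma second_derivative_at_local_min:
  fixes \<phi> \<phi>' :: "real \<Rightarrow> real"
  assumes d: "d > 0"
    and \<phi>': "\<And>\<tau>. \<bar>\<tau>\<bar> < d \<Longrightarrow> (\<phi> has_real_derivative \<phi>' \<tau>) (at \<tau>)"
    and \<phi>'': "(\<phi>' has_real_derivative l) (at 0)"
    and min: "\<And>\<tau>. \<bar>\<tau>\<bar> < d \<Longrightarrow> \<phi> 0 \<le> \<phi> \<tau>"
  shows "\<phi>' 0 = 0" "l \<ge> 0"
proof -
  show z: "\<phi>' 0 = 0"
    by (rule DERIV_local_min[OF \<phi>'[of 0] d]) (use d min in auto)
  show "l \<ge> 0"
  proof (rule ccontr)
    assume "\<not> l \<ge> 0"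
    then obtain k where k: "k > 0" "\<And>h. h > 0 \<Longrightarrow> h < k \<Longrightarrow> \<phi>' (0 + h) < \<phi>' 0"
      using DERIV_neg_dec_right[OF \<phi>''] by force
    define t where "t = min k d / 2"
    have t: "0 < t" "t < k" "t < d" using k d by (auto simp: t_def)
    have "\<phi> t < \<phi> 0"
    proof (rule DERIV_neg_imp_decreasing_open[OF t(1)])
      fix x assume "0 < x" "x < t"
      then have "\<bar>x\<bar> < d" "\<phi>' x < 0" using k(2)[of x] z t by auto
      then show "\<exists>y. (\<phi> has_real_derivative y) (at x) \<and> y < 0" using \<phi>' by blast
    next
      show "continuous_on {0..t} \<phi>"
        by (rule DERIV_continuous_on[where D = \<phi>'], rule DERIV_subset[OF \<phi>']) (use t in auto)
    qed
    with min[of t] t show False by auto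
  qed
qed

text \<open>Necessary conditions for \<open>u\<close> to touch the shifted function \<open>x \<mapsto> v (x + \<psi>(x) e)\<close> from above at
  \<open>x\<close>, tested along the line through \<open>x\<close> in the direction \<open>y\<close>; here \<open>\<sigma>\<close> is \<open>\<psi>\<close> restricted to that
  line. Working line by line reduces the second-order chain rule to one for curves.\<close>

lemma touching_conditions:
  fixes u v :: "'a::real_normed_vector \<Rightarrow> real"
  assumes S: "open S"
    and u': "\<And>x. x \<in> S \<Longrightarrow> (u has_derivative blinfun_apply (u' x)) (at x)"
    and u'': "\<And>x. x \<in> S \<Longrightarrow> (u' has_derivative blinfun_apply (u'' x)) (at x)"
    and v': "\<And>x. x \<in> S \<Longrightarrow> (v has_derivative blinfun_apply (v' x)) (at x)"
    and v'': "\<And>x. x \<in> S \<Longrightarrow> (v' has_derivative blinfun_apply (v'' x)) (at x)"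
    and \<sigma>': "\<And>\<tau>. (\<sigma> has_real_derivative \<sigma>' \<tau>) (at \<tau>)"
    and \<sigma>'': "(\<sigma>' has_real_derivative \<sigma>2) (at 0)"
    and x: "x \<in> S" and P: "P \<in> S" "P = x + \<sigma> 0 *\<^sub>R e"
    and eq: "u x = v P"
    and le: "eventually (\<lambda>\<tau>. v (x + \<tau> *\<^sub>R y + \<sigma> \<tau> *\<^sub>R e) \<le> u (x + \<tau> *\<^sub>R y)) (at 0)"
  shows "u' x y = v' P (y + \<sigma>' 0 *\<^sub>R e)"
    and "v'' P (y + \<sigma>' 0 *\<^sub>R e) (y + \<sigma>' 0 *\<^sub>R e) + \<sigma>2 * v' P e \<le> u'' x y y"
proof -
  define \<xi> where "\<xi> \<tau> = x + \<tau> *\<^sub>R y" for \<tau> :: real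
  define \<gamma> where "\<gamma> \<tau> = x + \<tau> *\<^sub>R y + \<sigma> \<tau> *\<^sub>R e" for \<tau>
  have \<xi>: "(\<xi> has_derivative (\<lambda>h. h *\<^sub>R y)) (at \<tau>)" for \<tau>
    unfolding \<xi>_def[abs_def] by (auto intro!: derivative_eq_intros)
  have \<gamma>: "(\<gamma> has_derivative (\<lambda>h. h *\<^sub>R (y + \<sigma>' \<tau> *\<^sub>R e))) (at \<tau>)" for \<tau>
    unfolding \<gamma>_def[abs_def]
    by (auto intro!: derivative_eq_intros \<sigma>'[unfolded has_field_derivative_def] simp: algebra_simps)
  have "isCont \<xi> 0" "isCont \<gamma> 0"
    using \<xi> \<gamma> has_derivative_continuous by blast+
  moreover have \<xi>0: "\<xi> 0 = x" and \<gamma>0: "\<gamma> 0 = P" by (simp_all add: \<xi>_def \<gamma>_def P)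
  ultimately have "eventually (\<lambda>\<tau>. \<xi> \<tau> \<in> S) (at 0)" "eventually (\<lambda>\<tau>. \<gamma> \<tau> \<in> S) (at 0)"
    using S x P(1) unfolding isCont_def by (auto intro: topological_tendstoD)
  with le have "eventually (\<lambda>\<tau>. \<xi> \<tau> \<in> S \<and> \<gamma> \<tau> \<in> S \<and> v (\<gamma> \<tau>) \<le> u (\<xi> \<tau>)) (at 0)"
    unfolding \<xi>_def \<gamma>_def by eventually_elim auto
  then obtain d where d: "d > 0"
    "\<And>\<tau>. \<tau> \<noteq> 0 \<Longrightarrow> dist \<tau> 0 < d \<Longrightarrow> \<xi> \<tau> \<in> S \<and> \<gamma> \<tau> \<in> S \<and> v (\<gamma> \<tau>) \<le> u (\<xi> \<tau>)"
    unfolding eventually_at by auto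
  have dd: "\<xi> \<tau> \<in> S \<and> \<gamma> \<tau> \<in> S \<and> v (\<gamma> \<tau>) \<le> u (\<xi> \<tau>)" if "\<bar>\<tau>\<bar> < d" for \<tau>
    using d(2)[of \<tau>] that x P(1) eq by (cases "\<tau> = 0") (auto simp: \<xi>0 \<gamma>0)
  define \<phi>' where "\<phi>' \<tau> = u' (\<xi> \<tau>) y - v' (\<gamma> \<tau>) (y + \<sigma>' \<tau> *\<^sub>R e)" for \<tau>
  have 1: "((\<lambda>\<tau>. u (\<xi> \<tau>) - v (\<gamma> \<tau>)) has_real_derivative \<phi>' \<tau>) (at \<tau>)" if "\<bar>\<tau>\<bar> < d" for \<tau>
  proof -
    have "((\<lambda>\<tau>. u (\<xi> \<tau>)) has_derivative (\<lambda>h. u' (\<xi> \<tau>) (h *\<^sub>R y))) (at \<tau>)"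
      using dd[OF that] by (intro has_derivative_compose[OF \<xi>] u') auto
    moreover have "((\<lambda>\<tau>. v (\<gamma> \<tau>)) has_derivative (\<lambda>h. v' (\<gamma> \<tau>) (h *\<^sub>R (y + \<sigma>' \<tau> *\<^sub>R e)))) (at \<tau>)"
      using dd[OF that] by (intro has_derivative_compose[OF \<gamma>] v') auto
    ultimately have "((\<lambda>\<tau>. u (\<xi> \<tau>) - v (\<gamma> \<tau>)) has_derivative
       (\<lambda>h. u' (\<xi> \<tau>) (h *\<^sub>R y) - v' (\<gamma> \<tau>) (h *\<^sub>R (y + \<sigma>' \<tau> *\<^sub>R e)))) (at \<tau>)"
      by (rule has_derivative_diff)
    then show ?thesis
      unfolding has_field_derivative_def \<phi>'_def
      by (rule has_derivative_eq_rhs) (simp add: fun_eq_iff blinfun.scaleR_right right_diff_distrib left_diff_distrib mult.commute)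
  qed
  let ?Y = "y + \<sigma>' 0 *\<^sub>R e"
  have 2: "(\<phi>' has_real_derivative (u'' x y y - (v'' P ?Y ?Y + \<sigma>2 * v' P e))) (at 0)"
  proof -
    have "((\<lambda>\<tau>. u' (\<xi> \<tau>)) has_derivative (\<lambda>h. u'' x (h *\<^sub>R y))) (at 0)"
      by (rule has_derivative_compose[OF \<xi>]) (use u''[OF x] \<xi>0 in simp)
    from blinfun.FDERIV[OF this has_derivative_const[of y]]
    have a: "((\<lambda>\<tau>. u' (\<xi> \<tau>) y) has_derivative (\<lambda>h. u'' x (h *\<^sub>R y) y)) (at 0)"
      by (simp add: \<xi>0 blinfun.zero_right)
    have "((\<lambda>\<tau>. v' (\<gamma> \<tau>)) has_derivative (\<lambda>h. v'' P (h *\<^sub>R ?Y))) (at 0)"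
      by (rule has_derivative_compose[OF \<gamma>]) (use v''[OF P(1)] \<gamma>0 in simp)
    moreover have "((\<lambda>\<tau>. y + \<sigma>' \<tau> *\<^sub>R e) has_derivative (\<lambda>h. (h * \<sigma>2) *\<^sub>R e)) (at 0)"
      using \<sigma>'' unfolding has_field_derivative_def
      by (auto intro!: derivative_eq_intros simp: mult.commute)
    ultimately have b: "((\<lambda>\<tau>. v' (\<gamma> \<tau>) (y + \<sigma>' \<tau> *\<^sub>R e)) has_derivative
        (\<lambda>h. v' (\<gamma> 0) ((h * \<sigma>2) *\<^sub>R e) + v'' P (h *\<^sub>R ?Y) ?Y)) (at 0)"
      by (rule blinfun.FDERIV)
    show ?thesis
      unfolding has_field_derivative_def \<phi>'_def[abs_def]
      by (rule has_derivative_eq_rhs, rule has_derivative_diff[OF a b])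
         (simp add: fun_eq_iff blinfun.bilinear_simps \<xi>0 \<gamma>0 algebra_simps)
  qed
  have min: "u (\<xi> 0) - v (\<gamma> 0) \<le> u (\<xi> \<tau>) - v (\<gamma> \<tau>)" if "\<bar>\<tau>\<bar> < d" for \<tau>
    using dd[OF that] eq by (simp add: \<xi>0 \<gamma>0)
  from second_derivative_at_local_min[OF d(1) 1 2 min]
  show "u' x y = v' P ?Y" "v'' P ?Y ?Y + \<sigma>2 * v' P e \<le> u'' x y y"
    by (auto simp: \<phi>'_def \<xi>0 \<gamma>0)
qed

section \<open>The boundary touching lemma\<close>

text \<open>The barrier restricted to a line, in the form demanded of \<open>\<sigma>\<close> above.\<close>

lemma gaussian_line_derivatives:
  fixes z y :: "'a::real_inner"
  shows "((\<lambda>\<tau>. \<epsilon> * (exp (- \<alpha> * (norm (z + \<tau> *\<^sub>R y))\<^sup>2) - k) + m) has_real_derivative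
      - (2 * \<epsilon> * \<alpha> * exp (- \<alpha> * (norm (z + \<tau> *\<^sub>R y))\<^sup>2) * (z \<bullet> y + \<tau> * (y \<bullet> y)))) (at \<tau>)"
    and "((\<lambda>\<tau>. - (2 * \<epsilon> * \<alpha> * exp (- \<alpha> * (norm (z + \<tau> *\<^sub>R y))\<^sup>2) * (z \<bullet> y + \<tau> * (y \<bullet> y))))
      has_real_derivative
      2 * \<epsilon> * \<alpha> * exp (- \<alpha> * (norm z)\<^sup>2) * (2 * \<alpha> * ((z \<bullet> y) * (z \<bullet> y)) - y \<bullet> y)) (at 0)"
proof -
  have n: "(norm (z + \<tau> *\<^sub>R y))\<^sup>2 = z \<bullet> z + 2 * \<tau> * (z \<bullet> y) + \<tau> * \<tau> * (y \<bullet> y)" for \<tau>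
    unfolding power2_norm_eq_inner by (simp add: inner_add_left inner_add_right inner_commute[of y z] algebra_simps)
  show "((\<lambda>\<tau>. \<epsilon> * (exp (- \<alpha> * (norm (z + \<tau> *\<^sub>R y))\<^sup>2) - k) + m) has_real_derivative
      - (2 * \<epsilon> * \<alpha> * exp (- \<alpha> * (norm (z + \<tau> *\<^sub>R y))\<^sup>2) * (z \<bullet> y + \<tau> * (y \<bullet> y)))) (at \<tau>)"
    unfolding n by (rule derivative_eq_intros refl)+ (simp add: algebra_simps)
  show "((\<lambda>\<tau>. - (2 * \<epsilon> * \<alpha> * exp (- \<alpha> * (norm (z + \<tau> *\<^sub>R y))\<^sup>2) * (z \<bullet> y + \<tau> * (y \<bullet> y))))
      has_real_derivative
      2 * \<epsilon> * \<alpha> * exp (- \<alpha> * (norm z)\<^sup>2) * (2 * \<alpha> * ((z \<bullet> y) * (z \<bullet> y)) - y \<bullet> y)) (at 0)"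
    unfolding n unfolding power2_norm_eq_inner by (rule derivative_eq_intros refl)+ (simp add: algebra_simps)
qed

lemma increasing_along:
  fixes v :: "'a::real_normed_vector \<Rightarrow> real"
  assumes B: "convex B" and v': "\<And>x. x \<in> B \<Longrightarrow> (v has_derivative blinfun_apply (v' x)) (at x)"
    and pos: "\<And>x. x \<in> B \<Longrightarrow> v' x e > 0"
    and x: "x \<in> B" "x + s *\<^sub>R e \<in> B" and s: "s > 0"
  shows "v x < v (x + s *\<^sub>R e)"
proof -
  have in_B: "x + \<tau> *\<^sub>R e \<in> B" if "0 \<le> \<tau>" "\<tau> \<le> s" for \<tau>
  proof -
    have "(1 - \<tau> / s) *\<^sub>R x + (\<tau> / s) *\<^sub>R (x + s *\<^sub>R e) \<in> B"
      using that s by (intro convexD[OF B x]) (auto simp: field_simps)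
    also have "(1 - \<tau> / s) *\<^sub>R x + (\<tau> / s) *\<^sub>R (x + s *\<^sub>R e) = x + \<tau> *\<^sub>R e"
      using s by (simp add: scaleR_left_diff_distrib scaleR_add_right)
    finally show ?thesis .
  qed
  have "(\<lambda>\<tau>. v (x + \<tau> *\<^sub>R e)) 0 < (\<lambda>\<tau>. v (x + \<tau> *\<^sub>R e)) s"
  proof (rule DERIV_pos_imp_increasing[OF s])
    fix \<tau> assume \<tau>: "0 \<le> \<tau>" "\<tau> \<le> s"
    have "((\<lambda>\<tau>. x + \<tau> *\<^sub>R e) has_derivative (\<lambda>h. h *\<^sub>R e)) (at \<tau>)"
      by (auto intro!: derivative_eq_intros)
    then have "((\<lambda>\<tau>. v (x + \<tau> *\<^sub>R e)) has_derivative (\<lambda>h. v' (x + \<tau> *\<^sub>R e) (h *\<^sub>R e))) (at \<tau>)"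
      by (rule has_derivative_compose) (rule v'[OF in_B[OF \<tau>]])
    then have "((\<lambda>\<tau>. v (x + \<tau> *\<^sub>R e)) has_real_derivative v' (x + \<tau> *\<^sub>R e) e) (at \<tau>)"
      unfolding has_field_derivative_def
      by (rule has_derivative_eq_rhs) (simp add: fun_eq_iff blinfun.scaleR_right)
    then show "\<exists>l. ((\<lambda>\<tau>. v (x + \<tau> *\<^sub>R e)) has_real_derivative l) (at \<tau>) \<and> 0 < l"
      using pos[OF in_B[OF \<tau>]] by blast
  qed
  then show ?thesis by simp
qed

text \<open>The substitute for the Hopf lemma. On a small ball around \<open>p\<close> the graph of \<open>v\<close> is moved along
  \<open>e\<close> by \<open>\<epsilon> h + m\<close>, where \<open>h\<close> is the barrier vanishing on the sphere of radius \<open>R\<close> about \<open>c\<close> and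
  positive inside. For \<open>m = -2\<epsilon>\<close> the moved function lies strictly below \<open>u\<close>; for \<open>m = 0\<close> it has
  reached \<open>u\<close> at \<open>p\<close>. At the first contact the values of \<open>u\<close> and of \<open>v\<close> at the shifted point agree,
  so the curvature hypothesis applies there. But ellipticity and the strict subsolution
  property of the moved function give the opposite strict inequality. Contact on the boundary of
  the small ball is excluded in two ways: outside the ball about \<open>c\<close> the shift goes backwards
  because \<open>h < 0\<close>, and inside there is a positive gap between \<open>u\<close> and \<open>v\<close> by compactness.\<close>

lemma boundary_touching_impossible:
  fixes u v :: "'a::euclidean_space \<Rightarrow> real"
  assumes S: "open S" and e: "norm e = 1"
    and u': "\<And>x. x \<in> S \<Longrightarrow> (u has_derivative blinfun_apply (u' x)) (at x)"
    and u'': "\<And>x. x \<in> S \<Longrightarrow> (u' has_derivative blinfun_apply (u'' x)) (at x)"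
    and v': "\<And>x. x \<in> S \<Longrightarrow> (v has_derivative blinfun_apply (v' x)) (at x)"
    and v'': "\<And>x. x \<in> S \<Longrightarrow> (v' has_derivative blinfun_apply (v'' x)) (at x)"
    and v''_cont: "continuous_on S v''"
    and H: "\<And>x s. x \<in> S \<Longrightarrow> x + s *\<^sub>R e \<in> S \<Longrightarrow> u x = v (x + s *\<^sub>R e) \<Longrightarrow>
              mean_curvature u x \<le> mean_curvature v (x + s *\<^sub>R e)"
    and ge: "\<And>x. x \<in> S \<Longrightarrow> v x \<le> u x"
    and p: "p \<in> S" "u p = v p" "v' p e > 0"
    and R: "R > 0" "dist c p = R"
    and gt: "\<And>x. x \<in> S \<Longrightarrow> x \<in> cball c R \<Longrightarrow> x \<noteq> p \<Longrightarrow> v x < u x"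
  shows False
proof -
  define \<kappa>0 where "\<kappa>0 = v' p e / 2"
  define M0 where "M0 = max (norm (v' p)) (norm (v'' p)) + 1"
  define M where "M = max M0 (2 * R)"
  have k0: "\<kappa>0 > 0" "\<kappa>0 < v' p e" using p by (auto simp: \<kappa>0_def)
  have M: "M > 0" "M0 \<le> M" "2 * R \<le> M" using R by (auto simp: M_def)
  have c1: "(v' \<longlongrightarrow> v' p) (nhds p)"
    using has_derivative_continuous[OF v''[OF p(1)]] by (simp add: continuous_within tendsto_at_iff_tendsto_nhds)
  have c2: "(v'' \<longlongrightarrow> v'' p) (nhds p)"
    using v''_cont S p(1) by (simp add: continuous_on_eq_continuous_at isCont_def tendsto_at_iff_tendsto_nhds)
  have "eventually (\<lambda>x. x \<in> S) (nhds p)" using S p(1) by (rule eventually_nhds_in_open)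
  moreover have "eventually (\<lambda>x. v' x e > \<kappa>0) (nhds p)"
    by (rule order_tendstoD(1)[OF _ k0(2)]) (intro tendsto_intros c1)
  moreover have "eventually (\<lambda>x. norm (v' x) < M0) (nhds p)"
    by (rule order_tendstoD(2)[OF tendsto_norm[OF c1]]) (simp add: M0_def)
  moreover have "eventually (\<lambda>x. norm (v'' x) < M0) (nhds p)"
    by (rule order_tendstoD(2)[OF tendsto_norm[OF c2]]) (simp add: M0_def)
  ultimately have "eventually (\<lambda>x. x \<in> S \<and> v' x e > \<kappa>0 \<and> norm (v' x) < M0 \<and> norm (v'' x) < M0) (nhds p)"
    by eventually_elim auto
  then obtain r0 where r0: "r0 > 0" and
    near: "\<And>x. x \<in> ball p r0 \<Longrightarrow> x \<in> S \<and> v' x e > \<kappa>0 \<and> norm (v' x) < M0 \<and> norm (v'' x) < M0"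
    unfolding eventually_nhds_metric by (auto simp: dist_commute)
  \<comment> \<open>The bound \<open>R / 2\<close> keeps the small ball away from \<open>c\<close>, where the barrier degenerates; \<open>r0 / 3\<close>
    leaves room for shifts of length up to \<open>r\<close>.\<close>
  define r where "r = min (r0 / 3) (R / 2)"
  have r: "r > 0" "2 * r < r0" "r \<le> R / 2" using r0 R by (auto simp: r_def)

  obtain \<alpha> where al: "\<alpha> > 0" and strict:
    "\<And>(q::'a) z (A :: 'a \<Rightarrow>\<^sub>L 'a \<Rightarrow>\<^sub>L real) \<kappa> d.
      norm q \<le> M \<Longrightarrow> norm z \<le> M \<Longrightarrow> norm A \<le> M \<Longrightarrow> \<kappa>0 \<le> \<kappa> \<Longrightarrow> \<kappa> \<le> M \<Longrightarrow> R / 2 \<le> norm z \<Longrightarrow>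
      0 < d \<Longrightarrow> d \<le> 1 \<Longrightarrow>
      mc_op q (\<lambda>x. blinfun_apply (blinfun_apply A x)) <
      mc_op (q - (d * \<kappa>) *\<^sub>R z)
       (\<lambda>x y. A (x - (d * (z \<bullet> x)) *\<^sub>R e) (y - (d * (z \<bullet> y)) *\<^sub>R e)
          + d * \<kappa> * (2 * \<alpha> * ((z \<bullet> x) * (z \<bullet> y)) - x \<bullet> y))"
    using mc_op_strict_increase[of M \<kappa>0 "R / 2" e] M k0 R e by auto
  define h where "h x = exp (- \<alpha> * (norm (x - c))\<^sup>2) - exp (- \<alpha> * R\<^sup>2)" for x
  have h1: "\<bar>h x\<bar> \<le> 1" for x
  proof -
    have "0 < exp (- \<alpha> * (norm (x - c))\<^sup>2)" "exp (- \<alpha> * (norm (x - c))\<^sup>2) \<le> 1"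
      "0 < exp (- \<alpha> * R\<^sup>2)" "exp (- \<alpha> * R\<^sup>2) \<le> 1" using al by auto
    then show ?thesis unfolding h_def by linarith
  qed
  have hp: "h p = 0" using R by (simp add: h_def dist_norm norm_minus_commute)
  have h_neg: "h x < 0" if "x \<notin> cball c R" for x
    using that R al by (auto simp: h_def dist_norm norm_minus_commute intro!: power_strict_mono)
  have h_cont: "continuous_on X h" for X
    unfolding h_def[abs_def] by (intro continuous_intros)

  have v_cont: "continuous_on (ball p r0) v"
    by (rule has_derivative_continuous_on) (use v' near in \<open>blast intro: has_derivative_at_withinI\<close>)
  have u_cont: "continuous_on (ball p r0) u"
    by (rule has_derivative_continuous_on) (use u' near in \<open>blast intro: has_derivative_at_withinI\<close>)
  have v_inc: "v x < v (x + s *\<^sub>R e)" if "x \<in> ball p r0" "x + s *\<^sub>R e \<in> ball p r0" "s > 0" for x s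
    by (rule increasing_along[where B = "ball p r0" and v' = v'])
       (use that near k0 v' in \<open>auto intro: order_less_trans simp del: mem_ball\<close>)
  have v_lip: "v (x + s *\<^sub>R e) \<le> v x + M * \<bar>s\<bar>" if "x \<in> ball p r0" "x + s *\<^sub>R e \<in> ball p r0" for x s
  proof -
    have "norm (v (x + s *\<^sub>R e) - v x) \<le> M * norm (x + s *\<^sub>R e - x)"
    proof (rule differentiable_bound[OF convex_ball _ _ that(2,1)])
      fix x assume "x \<in> ball p r0"
      then show "(v has_derivative blinfun_apply (v' x)) (at x within ball p r0)"
        "onorm (blinfun_apply (v' x)) \<le> M"
        using v' near M by (fastforce intro: has_derivative_at_withinI simp: norm_blinfun.rep_eq[symmetric])+
    qed
    then show ?thesis using e by simp
  qed

  define K where "K = cball p r"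
  have K: "x \<in> ball p r0" "x \<in> S" if "x \<in> K" for x
    using that r near[of x] by (auto simp: K_def)

  have "\<exists>\<mu>>0. \<forall>x\<in>sphere p r \<inter> cball c R. \<mu> \<le> u x - v x"
  proof (cases "sphere p r \<inter> cball c R = {}")
    case False
    have "continuous_on (sphere p r \<inter> cball c R) (\<lambda>x. u x - v x)"
      using r by (intro continuous_on_diff continuous_on_subset[OF u_cont] continuous_on_subset[OF v_cont]) auto
    from continuous_attains_inf[OF _ False this] obtain x0 where
      x0: "x0 \<in> sphere p r" "x0 \<in> cball c R" "\<forall>x\<in>sphere p r \<inter> cball c R. u x0 - v x0 \<le> u x - v x"
      by (auto simp: compact_Int)
    have "x0 \<in> S" using x0(1) r near[of x0] by auto
    then have "v x0 < u x0" using gt[OF _ x0(2)] x0(1) r by auto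
    with x0(3) show ?thesis by (intro exI[of _ "u x0 - v x0"]) auto
  qed (auto intro: exI[of _ 1])
  then obtain \<mu> where \<mu>: "\<mu> > 0" "\<And>x. x \<in> sphere p r \<Longrightarrow> x \<in> cball c R \<Longrightarrow> \<mu> \<le> u x - v x"
    by auto

  \<comment> \<open>The three bounds keep shifted points in the ball where \<open>v\<close> is controlled, keep the shift from
    closing the gap \<open>\<mu>\<close>, and make the parameter \<open>d\<close> at most 1.\<close>
  define \<epsilon> where "\<epsilon> = min (r / 3) (min (\<mu> / (2 * M)) (1 / (2 * \<alpha>)))"
  have "\<epsilon> \<le> \<mu> / (2 * M)" "\<epsilon> \<le> 1 / (2 * \<alpha>)" by (auto simp: \<epsilon>_def)
  then have ep: "\<epsilon> > 0" "3 * \<epsilon> \<le> r" "M * \<epsilon> < \<mu>" "2 * \<epsilon> * \<alpha> \<le> 1"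
    using r \<mu> M al by (auto simp: \<epsilon>_def field_simps)

  have eh: "\<epsilon> * h x \<le> \<epsilon>" for x
    using mult_left_mono[of "h x" 1 \<epsilon>] h1[of x] ep(1) by simp

  define P where "P x m = x + (\<epsilon> * h x + m) *\<^sub>R e" for x m
  have P_ball: "P x m \<in> ball p r0" if "x \<in> K" "-2 * \<epsilon> \<le> m" "m \<le> 0" for x m
  proof -
    have "\<bar>\<epsilon> * h x\<bar> \<le> \<epsilon>" using h1[of x] ep(1) by (simp add: abs_mult)
    then have "norm (P x m - x) \<le> 3 * \<epsilon>" unfolding P_def using that e by simp
    then have "norm (P x m - p) \<le> 2 * r"
      using norm_triangle_ineq[of "P x m - x" "x - p"] that ep(2)
      by (simp add: K_def dist_norm norm_minus_commute)
    then show ?thesis using r by (simp add: dist_norm norm_minus_commute)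
  qed
  have v_below: "v (P x m) < v x" if "x \<in> K" "-2 * \<epsilon> \<le> m" "m \<le> 0" "\<epsilon> * h x + m < 0" for x m
  proof -
    have "P x m + (- (\<epsilon> * h x + m)) *\<^sub>R e = x"
      unfolding P_def scaleR_minus_left by simp
    then show ?thesis
      using v_inc[of "P x m" "- (\<epsilon> * h x + m)"] P_ball[OF that(1-3)] K[OF that(1)] that(4) by simp
  qed

  \<comment> \<open>The pairs of a point and an offset for which the moved function has reached \<open>u\<close>; a pair with least
    offset is a first contact.\<close>
  define T where "T = (K \<times> {-2 * \<epsilon>..0}) \<inter> (\<lambda>(x, m). u x - v (P x m)) -` {..0}"
  have "compact T"
  proof -
    have P_cont: "continuous_on (K \<times> {-2 * \<epsilon>..0}) (\<lambda>z. P (fst z) (snd z))"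
      unfolding P_def by (intro continuous_intros continuous_on_compose2[OF h_cont[of UNIV]]) auto
    have "continuous_on (K \<times> {-2 * \<epsilon>..0}) (\<lambda>z. u (fst z) - v (P (fst z) (snd z)))"
      by (intro continuous_on_diff continuous_on_compose2[OF u_cont] continuous_on_compose2[OF v_cont]
        P_cont continuous_intros) (use K P_ball in auto)
    then have "closed T" unfolding T_def case_prod_unfold
      by (intro continuous_closed_preimage) (auto simp: K_def closed_Times)
    moreover have "compact (K \<times> {-2 * \<epsilon>..0})" by (simp add: K_def compact_Times)
    ultimately have "compact ((K \<times> {-2 * \<epsilon>..0}) \<inter> T)"
      by (simp add: compact_Int_closed)
    then show ?thesis by (simp add: T_def)
  qed
  moreover have "(p, 0) \<in> T" using r ep p hp by (simp add: T_def P_def K_def)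
  ultimately obtain xm where "xm \<in> T" and least: "\<And>ym. ym \<in> T \<Longrightarrow> snd xm \<le> snd ym"
    using continuous_attains_inf[of T snd] continuous_on_snd[OF continuous_on_id, of T]
    by (metis empty_iff)
  then obtain x m where xm: "xm = (x, m)" "x \<in> K" "-2 * \<epsilon> \<le> m" "m \<le> 0" "u x \<le> v (P x m)"
    by (cases xm) (auto simp: T_def)

  have m: "-2 * \<epsilon> < m"
  proof (rule ccontr)
    assume "\<not> -2 * \<epsilon> < m"
    then have "\<epsilon> * h x + m < 0" using xm(3) eh[of x] ep(1) by auto
    from v_below[OF xm(2-4) this] ge[OF K(2)[OF xm(2)]] xm(5) show False by simp
  qed
  have touch: "v (P y m) \<le> u y" if "y \<in> K" for y
  proof (rule ccontr)
    assume "\<not> v (P y m) \<le> u y"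
    then have pos: "v (P y m) - u y > 0" by simp
    \<comment> \<open>Lowering the offset by such a small \<open>t\<close> would still leave a point of overlap, contradicting
    minimality of \<open>m\<close>.\<close>
    define t where "t = min (m + 2 * \<epsilon>) ((v (P y m) - u y) / M)"
    have t: "t > 0" "-2 * \<epsilon> \<le> m - t" "m - t < m" using m pos M by (auto simp: t_def)
    have "M * t \<le> v (P y m) - u y" using M by (simp add: t_def min_def field_simps)
    have "(y, m - t) \<notin> T" using least[of "(y, m - t)"] xm(1) t by auto
    then have "v (P y (m - t)) < u y" using that t xm(4) by (auto simp: T_def)
    moreover have "v (P y m) \<le> v (P y (m - t)) + M * t"
      using v_lip[of "P y (m - t)" t] P_ball[OF that, of m] P_ball[OF that, of "m - t"] t xm
      by (simp add: P_def algebra_simps)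
    ultimately show False using \<open>M * t \<le> v (P y m) - u y\<close> by simp
  qed
  have eq: "u x = v (P x m)" using touch[OF xm(2)] xm(5) by simp
  have interior: "x \<in> ball p r"
  proof (rule ccontr)
    assume "x \<notin> ball p r"
    then have sph: "x \<in> sphere p r" using xm(2) by (auto simp: K_def)
    have nonneg: "0 \<le> \<epsilon> * h x + m"
      using v_below[OF xm(2-4)] ge[OF K(2)[OF xm(2)]] eq by fastforce
    then have "\<not> h x < 0" using xm(4) mult_pos_neg[OF ep(1), of "h x"] by linarith
    then have "x \<in> cball c R" using h_neg by blast
    note \<mu>(2)[OF sph this]
    moreover have "M * \<bar>\<epsilon> * h x + m\<bar> \<le> M * \<epsilon>"
      using nonneg xm(4) eh[of x] M by (intro mult_left_mono) auto
    moreover have "v (P x m) \<le> v x + M * \<bar>\<epsilon> * h x + m\<bar>"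
      using v_lip[of x "\<epsilon> * h x + m"] P_ball[OF xm(2-4)] K[OF xm(2)] by (simp add: P_def)
    ultimately show False using eq ep(3) by simp
  qed

  define z where "z = x - c"
  define d where "d = 2 * \<epsilon> * \<alpha> * exp (- \<alpha> * (norm z)\<^sup>2)"
  define \<kappa> where "\<kappa> = v' (P x m) e"
  have PS: "P x m \<in> S" and PM: "\<kappa>0 \<le> \<kappa>" "norm (v' (P x m)) \<le> M" "norm (v'' (P x m)) \<le> M"
    using near[OF P_ball[OF xm(2-4)]] M by (auto simp: \<kappa>_def)
  have kM: "\<kappa> \<le> M" using norm_blinfun[of "v' (P x m)" e] PM(2) e by (simp add: \<kappa>_def)
  have "exp (- \<alpha> * (norm z)\<^sup>2) \<le> 1" using al by simp
  then have d: "0 < d" "d \<le> 1"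
    using ep al mult_mono[OF ep(4), of "exp (- \<alpha> * (norm z)\<^sup>2)" 1] by (auto simp: d_def)
  have zb: "R / 2 \<le> norm z" "norm z \<le> M"
  proof -
    have "norm (x - p) \<le> R / 2" using interior r by (simp add: dist_norm norm_minus_commute)
    moreover have "norm (p - c) = R" using R by (simp add: dist_norm norm_minus_commute)
    ultimately show "R / 2 \<le> norm z" "norm z \<le> M"
      using norm_triangle_ineq[of "x - p" "p - c"] norm_triangle_ineq[of "x - c" "p - x"] M R
      by (auto simp: z_def norm_minus_commute)
  qed

  have first: "u' x y = v' (P x m) (y - (d * (z \<bullet> y)) *\<^sub>R e)"
    and second: "v'' (P x m) (y - (d * (z \<bullet> y)) *\<^sub>R e) (y - (d * (z \<bullet> y)) *\<^sub>R e)
      + d * \<kappa> * (2 * \<alpha> * ((z \<bullet> y) * (z \<bullet> y)) - y \<bullet> y) \<le> u'' x y y" for y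
  proof -
    define \<sigma> where "\<sigma> \<tau> = \<epsilon> * (exp (- \<alpha> * (norm (z + \<tau> *\<^sub>R y))\<^sup>2) - exp (- \<alpha> * R\<^sup>2)) + m" for \<tau>
    define \<sigma>' where "\<sigma>' \<tau> = - (2 * \<epsilon> * \<alpha> * exp (- \<alpha> * (norm (z + \<tau> *\<^sub>R y))\<^sup>2) * (z \<bullet> y + \<tau> * (y \<bullet> y)))" for \<tau>
    have 1: "(\<sigma> has_real_derivative \<sigma>' \<tau>) (at \<tau>)" for \<tau>
      unfolding \<sigma>_def[abs_def] \<sigma>'_def by (rule gaussian_line_derivatives)
    have 2: "(\<sigma>' has_real_derivative d * (2 * \<alpha> * ((z \<bullet> y) * (z \<bullet> y)) - y \<bullet> y)) (at 0)"
      unfolding \<sigma>'_def[abs_def] d_def by (rule gaussian_line_derivatives)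
    have \<sigma>: "\<sigma> \<tau> = \<epsilon> * h (x + \<tau> *\<^sub>R y) + m" for \<tau>
      by (simp add: \<sigma>_def h_def z_def algebra_simps)
    have "((\<lambda>\<tau>. x + \<tau> *\<^sub>R y) \<longlongrightarrow> x + 0 *\<^sub>R y) (at 0)" by (intro tendsto_intros)
    then have "eventually (\<lambda>\<tau>. x + \<tau> *\<^sub>R y \<in> ball p r) (at 0)"
      by (rule topological_tendstoD) (use interior in auto)
    then have 3: "eventually (\<lambda>\<tau>. v (x + \<tau> *\<^sub>R y + \<sigma> \<tau> *\<^sub>R e) \<le> u (x + \<tau> *\<^sub>R y)) (at 0)"
    proof eventually_elim
      case (elim \<tau>)
      then show ?case using touch[of "x + \<tau> *\<^sub>R y"] by (simp add: P_def \<sigma> K_def)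
    qed
    have P0: "P x m = x + \<sigma> 0 *\<^sub>R e" by (simp add: P_def \<sigma>)
    have Y: "y + \<sigma>' 0 *\<^sub>R e = y - (d * (z \<bullet> y)) *\<^sub>R e"
      by (simp add: \<sigma>'_def d_def)
    note tc = touching_conditions[OF S u' u'' v' v'' 1 2 K(2)[OF xm(2)] PS P0 eq 3, unfolded Y]
    show "u' x y = v' (P x m) (y - (d * (z \<bullet> y)) *\<^sub>R e)" by (rule tc(1))
    show "v'' (P x m) (y - (d * (z \<bullet> y)) *\<^sub>R e) (y - (d * (z \<bullet> y)) *\<^sub>R e)
      + d * \<kappa> * (2 * \<alpha> * ((z \<bullet> y) * (z \<bullet> y)) - y \<bullet> y) \<le> u'' x y y"
      using tc(2) by (simp add: \<kappa>_def mult_ac)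
  qed

  define q where "q = grad v (P x m)"
  have q: "norm q \<le> M" using norm_grad_le[OF v'[OF PS]] PM(2) by (simp add: q_def)
  have xS: "x \<in> S" by (rule K(2)[OF xm(2)])
  have q': "grad u x = q - (d * \<kappa>) *\<^sub>R z"
  proof (subst vector_eq_rdot[symmetric], intro allI)
    fix y
    have "grad u x \<bullet> y = v' (P x m) y - d * (z \<bullet> y) * \<kappa>"
      using first[of y] by (simp add: grad_inner[OF u'[OF xS]] blinfun.diff_right blinfun.scaleR_right \<kappa>_def)
    then show "grad u x \<bullet> y = (q - (d * \<kappa>) *\<^sub>R z) \<bullet> y"
      by (simp add: grad_inner[OF v'[OF PS]] q_def inner_diff_left)
  qed
  define B where "B x' y = v'' (P x m) (x' - (d * (z \<bullet> x')) *\<^sub>R e) (y - (d * (z \<bullet> y)) *\<^sub>R e)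
      + d * \<kappa> * (2 * \<alpha> * ((z \<bullet> x') * (z \<bullet> y)) - x' \<bullet> y)" for x' y
  have "mc_op (grad u x) (\<lambda>x'. blinfun_apply (blinfun_apply (u'' x) x'))
      \<le> mc_op q (\<lambda>x'. blinfun_apply (blinfun_apply (v'' (P x m)) x'))"
    using H[OF xS PS[unfolded P_def] eq[unfolded P_def]]
    unfolding P_def[symmetric] q_def
    by (simp add: mean_curvature_eq_mc_op[OF S xS u' u''[OF xS]]
      mean_curvature_eq_mc_op[OF S PS v' v''[OF PS]] divide_le_cancel)
  also have "\<dots> < mc_op (grad u x) B"
    unfolding q' B_def[abs_def]
    by (rule strict[OF q zb(2) PM(3) PM(1) kM zb(1) d])
  also have "\<dots> \<le> mc_op (grad u x) (\<lambda>x'. blinfun_apply (blinfun_apply (u'' x) x'))"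
  proof (rule mc_op_mono)
    show "bilinear (\<lambda>x'. blinfun_apply (blinfun_apply (u'' x) x'))"
      by (auto simp: bilinear_def blinfun.bilinear_simps intro!: linearI)
    show "bilinear B"
      unfolding bilinear_def B_def
      by (auto simp: blinfun.bilinear_simps inner_add_left inner_add_right algebra_simps intro!: linearI)
    show "B y y \<le> u'' x y y" for y unfolding B_def by (rule second)
  qed
  finally show False by simp
qed

section \<open>The strong maximum principle\<close>

text \<open>By connectedness \<open>Z\<close> has a point that is not interior to it. The largest ball free of \<open>Z\<close>
  around a nearby point outside \<open>Z\<close> touches \<open>Z\<close>, perhaps at several points. Halving it towards one of
  them leaves a single contact, because the sphere is strictly curved.\<close>

lemma ball_touching_boundary_of_closed_set:
  fixes S Z :: "'a::euclidean_space set"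
  assumes S: "open S" "connected S" and Z: "closedin (top_of_set S) Z" "Z \<noteq> {}" "Z \<noteq> S"
  obtains c p R where "R > 0" "p \<in> Z" "dist c p = R" "cball c R \<inter> Z = {p}"
proof -
  have "\<not> openin (top_of_set S) Z"
    using S(2) Z unfolding connected_clopen by blast
  moreover have ZS: "Z \<subseteq> S" using Z(1) by (rule closedin_imp_subset)
  ultimately have "\<not> open Z" using S(1) by (simp add: openin_open_eq)
  then obtain z0 where z0: "z0 \<in> Z" "\<And>\<rho>. \<rho> > 0 \<Longrightarrow> \<not> ball z0 \<rho> \<subseteq> Z"
    unfolding open_contains_ball by blast
  obtain \<rho> where \<rho>: "\<rho> > 0" "cball z0 \<rho> \<subseteq> S"
    using S(1) ZS z0(1) by (meson open_contains_cball subsetD)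
  obtain q where q: "dist z0 q < \<rho> / 2" "q \<notin> Z"
    using z0(2)[of "\<rho> / 2"] \<rho>(1) by (meson half_gt_zero mem_ball subsetI)
  define D where "D = cball z0 \<rho> \<inter> Z"
  obtain F where F: "closed F" "Z = S \<inter> F" using Z(1) by (auto simp: closedin_closed)
  have "D = cball z0 \<rho> \<inter> F" using F(2) \<rho>(2) by (auto simp: D_def)
  then have "closed D" using F(1) by auto
  moreover have z0D: "z0 \<in> D" using z0(1) \<rho>(1) by (simp add: D_def)
  ultimately obtain p where p: "p \<in> D" "\<And>y. y \<in> D \<Longrightarrow> dist q p \<le> dist q y"
    using distance_attains_inf[of D q] by auto
  define R where "R = dist q p / 2"
  define c where "c = midpoint q p"
  have R: "R > 0" using q(2) p(1) by (auto simp: R_def D_def)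
  have qp: "dist q p < \<rho> / 2" using p(2)[OF z0D] q(1) by (simp add: dist_commute)
  have cp: "dist c p = R" "dist q c = R" by (simp_all add: c_def R_def dist_midpoint)
  have in_big: "x \<in> cball z0 \<rho>" if "x \<in> cball c R" for x
  proof -
    have "dist z0 x \<le> dist z0 q + dist q c + dist c x"
      by (meson add_right_mono dist_triangle order_trans)
    then show ?thesis using that q(1) qp cp by (simp add: R_def)
  qed
  have uniq: "x = p" if "x \<in> cball c R" "x \<in> Z" for x
  proof -
    have "x \<in> D" using in_big[OF that(1)] that(2) by (simp add: D_def)
    then have "2 * R \<le> norm (x - q)" using p(2)[of x] by (simp add: R_def dist_norm norm_minus_commute)
    define a b where "a = x - c" and "b = p - c"
    have "x - q = a + b" by (simp add: a_def b_def c_def midpoint_def algebra_simps flip: scaleR_2)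
    have "(2 * R)\<^sup>2 \<le> (norm (a + b))\<^sup>2"
      using \<open>2 * R \<le> norm (x - q)\<close> \<open>x - q = a + b\<close> R by (intro power_mono) auto
    then have "4 * R\<^sup>2 \<le> (norm (a + b))\<^sup>2" by (simp add: power_mult_distrib)
    moreover have "(norm a)\<^sup>2 \<le> R\<^sup>2" "(norm b)\<^sup>2 = R\<^sup>2"
      using that(1) cp(1) by (auto simp: a_def b_def dist_norm norm_minus_commute intro!: power_mono)
    \<comment> \<open>The parallelogram law forces \<open>a = b\<close>.\<close>
    moreover have "(norm (a + b))\<^sup>2 + (norm (a - b))\<^sup>2 = 2 * (norm a)\<^sup>2 + 2 * (norm b)\<^sup>2"
      by (simp add: power2_norm_eq_inner inner_add_left inner_add_right inner_diff_left inner_diff_right)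
    ultimately have "(norm (a - b))\<^sup>2 \<le> 0" by linarith
    then show "x = p" by (simp add: a_def b_def)
  qed
  show thesis
  proof (rule that[OF R _ cp(1)])
    show "p \<in> Z" using p(1) by (simp add: D_def)
    then show "cball c R \<inter> Z = {p}" using uniq cp(1) by auto
  qed
qed

text \<open>If both alternatives fail, the coincidence set is touched at a single point \<open>p\<close> by a ball in
  which \<open>u > v\<close>. The difference \<open>u - v\<close> is minimal at \<open>p\<close>, so the two derivatives agree there, and
  the sign condition on the maximum becomes positivity of the derivative of \<open>v\<close> itself.\<close>

theorem strong_maximum_principle_sliding:
  fixes u v :: "'a::euclidean_space \<Rightarrow> real"
  assumes S: "open S" "connected S" and e: "norm e = 1"
    and u: "C2_on S u" and v: "C2_on S v"
    and H: "\<And>x s. x \<in> S \<Longrightarrow> x + s *\<^sub>R e \<in> S \<Longrightarrow> u x = v (x + s *\<^sub>R e) \<Longrightarrow>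
              mean_curvature u x \<le> mean_curvature v (x + s *\<^sub>R e)"
    and ge: "\<And>x. x \<in> S \<Longrightarrow> v x \<le> u x"
    and pos: "\<And>x. x \<in> S \<Longrightarrow> max (frechet_derivative u (at x) e) (frechet_derivative v (at x) e) > 0"
  shows "(\<forall>x\<in>S. v x < u x) \<or> (\<forall>x\<in>S. u x = v x)"
proof (rule ccontr)
  assume neg: "\<not> ?thesis"
  obtain u' u'' where u': "\<And>x. x \<in> S \<Longrightarrow> (u has_derivative blinfun_apply (u' x)) (at x)"
    and u'': "\<And>x. x \<in> S \<Longrightarrow> (u' has_derivative blinfun_apply (u'' x)) (at x)"
    using u unfolding C2_on_def by blast
  obtain v' v'' where v': "\<And>x. x \<in> S \<Longrightarrow> (v has_derivative blinfun_apply (v' x)) (at x)"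
    and v'': "\<And>x. x \<in> S \<Longrightarrow> (v' has_derivative blinfun_apply (v'' x)) (at x)" "continuous_on S v''"
    using v unfolding C2_on_def by blast
  define Z where "Z = S \<inter> (\<lambda>x. u x - v x) -` {0}"
  have uv: "((\<lambda>x. u x - v x) has_derivative (\<lambda>y. u' x y - v' x y)) (at x)" if "x \<in> S" for x
    by (rule has_derivative_diff[OF u'[OF that] v'[OF that]])
  have "continuous_on S (\<lambda>x. u x - v x)"
    by (rule has_derivative_continuous_on) (use uv in \<open>blast intro: has_derivative_at_withinI\<close>)
  then have "closedin (top_of_set S) Z"
    unfolding Z_def by (rule continuous_closedin_preimage) simp
  moreover have "Z \<noteq> {}" "Z \<noteq> S"
    using neg ge unfolding Z_def by fastforce+
  ultimately obtain c p R where ball: "R > 0" "p \<in> Z" "dist c p = R" "cball c R \<inter> Z = {p}"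
    using ball_touching_boundary_of_closed_set[OF S] by metis
  have p: "p \<in> S" "u p = v p" using ball(2) by (auto simp: Z_def)
  have "(\<lambda>y. u' p y - v' p y) = (\<lambda>y. 0)"
    by (rule differential_zero_maxmin[OF p(1) S(1) uv[OF p(1)]]) (use ge p in auto)
  then have "u' p e = v' p e" by (metis eq_iff_diff_eq_0)
  then have v'e: "v' p e > 0"
    using pos[OF p(1)] frechet_derivative_at[OF u'[OF p(1)]] frechet_derivative_at[OF v'[OF p(1)]] by simp
  have gt: "v x < u x" if "x \<in> S" "x \<in> cball c R" "x \<noteq> p" for x
    using ball(4) that ge[OF that(1)] unfolding Z_def by fastforce
  show False
    by (rule boundary_touching_impossible[OF S(1) e u' u'' v' v''(1) v''(2) H ge p v'e ball(1,3) gt])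
qed

section \<open>Application to the cylinder\<close>

lemma cylinder_eq_Times: "cylinder = {0<..<1} \<times> ball 0 1"
  by (auto simp: cylinder_def)

lemma open_cylinder: "open cylinder"
  unfolding cylinder_eq_Times by (intro open_Times) auto

lemma connected_cylinder: "connected cylinder"
  unfolding cylinder_eq_Times by (simp add: connected_Times)

lemma partial_t_eq_frechet_derivative:
  fixes f :: "real \<times> 'b::real_normed_vector \<Rightarrow> real"
  assumes "f differentiable at p"
  shows "partial_t f p = frechet_derivative f (at p) (1, 0)"
proof -
  let ?D = "frechet_derivative f (at p)"
  have D: "(f has_derivative ?D) (at p)"
    using assms by (simp add: frechet_derivative_works)
  have "((\<lambda>s. (s, snd p)) has_derivative (\<lambda>h. (h, 0))) (at (fst p))"
    by (auto intro!: derivative_eq_intros)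
  from has_derivative_compose[OF this, of f ?D] D
  have deriv: "((\<lambda>s. f (s, snd p)) has_derivative (\<lambda>h. ?D (h, 0))) (at (fst p))" by simp
  have scale: "?D (h, 0) = ?D (1, 0) * h" for h
  proof -
    have "?D (h, 0) = ?D (h *\<^sub>R (1, 0))" by simp
    also have "\<dots> = h *\<^sub>R ?D (1, 0)" by (rule linear_scale[OF has_derivative_linear[OF D]])
    finally show ?thesis by simp
  qed
  from deriv have "((\<lambda>s. f (s, snd p)) has_real_derivative ?D (1, 0)) (at (fst p))"
    unfolding has_field_derivative_def by (elim has_derivative_eq_rhs) (rule ext, rule scale)
  then show ?thesis unfolding partial_t_def by (rule DERIV_imp_deriv)
qed

theorem theorem3:
  fixes u v :: "real \<times> (real ^ 'm) \<Rightarrow> real"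
  assumes "C2_on cylinder u" and "C2_on cylinder v"
    and "\<And>t s y. (t, y) \<in> cylinder \<Longrightarrow> (s, y) \<in> cylinder \<Longrightarrow> u (t, y) = v (s, y) \<Longrightarrow>
           mean_curvature u (t, y) \<le> mean_curvature v (s, y)"
    and "\<And>p. p \<in> cylinder \<Longrightarrow> u p \<ge> v p"
    and "\<And>p. p \<in> cylinder \<Longrightarrow> max (partial_t u p) (partial_t v p) > 0"
  shows "(\<forall>p\<in>cylinder. u p > v p) \<or> (\<forall>p\<in>cylinder. u p = v p)"
proof (rule strong_maximum_principle_sliding[OF open_cylinder connected_cylinder _ assms(1,2)])
  show "norm (1 :: real, 0 :: real ^ 'm) = 1" by (simp add: norm_Pair)
  fix p :: "real \<times> (real ^ 'm)" assume p: "p \<in> cylinder"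
  show "v p \<le> u p" using assms(4)[OF p] .
  have "u differentiable at p" "v differentiable at p"
    using assms(1,2) p unfolding C2_on_def differentiable_def by blast+
  then show "max (frechet_derivative u (at p) (1, 0)) (frechet_derivative v (at p) (1, 0)) > 0"
    using assms(5)[OF p] by (simp add: partial_t_eq_frechet_derivative)
  fix s :: real
  assume "p + s *\<^sub>R (1, 0) \<in> cylinder" "u p = v (p + s *\<^sub>R (1, 0))"
  then show "mean_curvature u p \<le> mean_curvature v (p + s *\<^sub>R (1, 0))"
    using p assms(3)[of "fst p" "snd p" "fst p + s"] by (cases p) simp
qed

end
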